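(* Consider the single-buyer system with a truthful seller described in the context. For every horizon $T\ge1$ and every bidding policy $(Z_t)_{t\ge1}$ there exists a system (i.e. valuations $B$ and $S$ of the buyer and the seller) such that $$\mathbb E[R_T]\ge\frac1{36}\sqrt T.$$
   Context: **System.** There is one buyer with valuation $B\ge 0$, unknown to her, and one seller with valuation $S\ge 0$. The seller knows $S$ and asks for $S$ in every round. In each round $t$ the buyer either participates, by bidding $S$ and paying price $S$ ($Z_t=1$), or abstains ($Z_t=0$). If she participates she observes $Y_{b,t}$, her valuation $B$ plus independent unit-variance Gaussian noise, and her mean reward for the round is $B-S$. If she abstains her reward is deterministically $0$. **Bidding policy.** A sequence of random variables $(Z_t)_{t\ge1}$ with $Z_t\in\{0,1\}$ such that $Z_t$ is measurable with respect to the sigma-algebra generated by the past decisions and observed rewards $Z_1Y_{b,1},\dots,Z_{t-1}Y_{b,t-1}$. **Regret.** $R_T=T\max(B-S,0)-\sum_{t=1}^TZ_t(B-S)$. *)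

theory Defs
  imports "HOL-Probability.Probability"
begin

text \<open>
  What the buyer has seen before round \<open>t\<close>: the pairs \<open>(Z s, Z s * Y s)\<close> for the rounds
  \<open>1 \<le> s < t\<close>.
\<close>
type_synonym history = "nat \<Rightarrow> nat \<times> real"

definition history_space :: "nat \<Rightarrow> history measure" where
  "history_space t = (\<Pi>\<^sub>M s\<in>{1..<t}. count_space {0, 1} \<Otimes>\<^sub>M borel)"

text \<open>
  One and the same policy has to be run against different systems, so a policy is a family of
  measurable decision rules on histories rather than a process on a sample space.  By the
  Doob-Dynkin lemma these rules are exactly the decisions that are measurable with respect to the
  sigma-algebra generated by the history.  The rule takes the price \<open>S\<close> as an additional argument,
  because the buyer participates by bidding \<open>S\<close>; the valuation \<open>B\<close> is not an argument.  Rules that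
  ignore \<open>S\<close> are included.
\<close>
type_synonym policy = "real \<Rightarrow> nat \<Rightarrow> history \<Rightarrow> nat"

definition bidding_policy :: "policy \<Rightarrow> bool" where
  "bidding_policy \<pi> \<longleftrightarrow>
     (\<forall>S\<ge>0. \<forall>t\<ge>1. \<pi> S t \<in> history_space t \<rightarrow>\<^sub>M count_space {0, 1})"

text \<open>
  In the following, \<open>y t\<close> is the noisy valuation of round \<open>t\<close>.  It enters a decision only through
  the products \<open>Z s * y s\<close> of earlier rounds.  The conditional has to return \<open>undefined\<close> outside
  \<open>{1..<t}\<close> for the history to be a point of \<open>history_space t\<close>.
\<close>
fun decision :: "policy \<Rightarrow> real \<Rightarrow> (nat \<Rightarrow> real) \<Rightarrow> nat \<Rightarrow> nat" where
  "decision \<pi> S y t =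
     \<pi> S t (\<lambda>s. if s \<in> {1..<t}
       then (decision \<pi> S y s, real (decision \<pi> S y s) * y s) else undefined)"

declare decision.simps [simp del]

definition observed :: "policy \<Rightarrow> real \<Rightarrow> (nat \<Rightarrow> real) \<Rightarrow> nat \<Rightarrow> history" where
  "observed \<pi> S y t =
     (\<lambda>s\<in>{1..<t}. (decision \<pi> S y s, real (decision \<pi> S y s) * y s))"

definition regret :: "policy \<Rightarrow> real \<Rightarrow> real \<Rightarrow> (nat \<Rightarrow> real) \<Rightarrow> nat \<Rightarrow> real" where
  "regret \<pi> B S y T =
     real T * max (B - S) 0 - (\<Sum>t=1..T. real (decision \<pi> S y t) * (B - S))"

definition standard_gaussian_noise :: "'a measure \<Rightarrow> (nat \<Rightarrow> 'a \<Rightarrow> real) \<Rightarrow> bool" where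
  "standard_gaussian_noise M \<xi> \<longleftrightarrow>
     prob_space.indep_vars M (\<lambda>_. borel) \<xi> {1..} \<and>
     (\<forall>t\<ge>1. distributed M lborel (\<xi> t) (\<lambda>x. ennreal (std_normal_density x)))"

lemma decision_eq_observed: "decision \<pi> S y t = \<pi> S t (observed \<pi> S y t)"
  by (subst decision.simps) (simp add: observed_def restrict_def)

lemma decision_in_01:
  assumes "bidding_policy \<pi>" "0 \<le> S" "1 \<le> t"
  shows "decision \<pi> S y t \<in> {0, 1}"
  using assms(3)
proof (induction t rule: less_induct)
  case (less t)
  have "observed \<pi> S y t \<in> space (history_space t)"
    using less.IH by (auto simp: observed_def history_space_def space_PiM space_pair_measure)
  moreover have "\<pi> S t \<in> history_space t \<rightarrow>\<^sub>M count_space {0, 1}"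
    using assms(1,2) less.prems by (simp add: bidding_policy_def)
  ultimately show ?case
    by (metis decision_eq_observed measurable_space space_count_space)
qed

lemma decision_adapted:
  assumes "bidding_policy \<pi>" "0 \<le> S" "1 \<le> t"
  shows "(\<lambda>\<omega>. decision \<pi> S (\<lambda>s. Y s \<omega>) t)
    \<in> vimage_algebra \<Omega> (\<lambda>\<omega>. observed \<pi> S (\<lambda>s. Y s \<omega>) t) (history_space t)
      \<rightarrow>\<^sub>M count_space {0, 1}"
proof -
  have "observed \<pi> S y t \<in> space (history_space t)" for y
    using decision_in_01[OF assms(1,2)]
    by (auto simp: observed_def history_space_def space_PiM space_pair_measure)
  then have "(\<lambda>\<omega>. observed \<pi> S (\<lambda>s. Y s \<omega>) t)
    \<in> vimage_algebra \<Omega> (\<lambda>\<omega>. observed \<pi> S (\<lambda>s. Y s \<omega>) t) (history_space t)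
      \<rightarrow>\<^sub>M history_space t"
    by (intro measurable_vimage_algebra1) auto
  moreover have "\<pi> S t \<in> history_space t \<rightarrow>\<^sub>M count_space {0, 1}"
    using assms by (simp add: bidding_policy_def)
  ultimately show ?thesis
    unfolding decision_eq_observed[of _ _ _ t] by (rule measurable_compose)
qed

end

theory Submission imports Defs begin

text \<open>
  Fix the price \<open>S = 1\<close> and compare the valuations \<open>1 + \<delta>\<close> and \<open>1 - \<delta>\<close> with \<open>\<delta> = 1 / (4 * sqrt T)\<close>.
  If \<open>F\<close> is the fraction of rounds in which the buyer participates, the two expected regrets are
  \<open>\<delta> * T * (1 - E F)\<close> and \<open>\<delta> * T * E F\<close>, the expectations being taken under the respective laws of
  the noisy valuations.  Even if the buyer saw all \<open>T\<close> of these valuations, the two laws would be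
  hard to tell apart: the second moment of their likelihood ratio is \<open>exp (4 * \<delta>\<^sup>2 * T) = exp (1/4)\<close>,
  so that the expectations of \<open>F\<close> differ by at most \<open>1/2\<close> and the regrets add up to at least
  \<open>\<delta> * T / 2 = sqrt T / 8\<close>.
\<close>

declare One_nat_def [simp del]

section \<open>Likelihood ratio of a shifted Gaussian\<close>

definition gaussian_lr :: "real \<Rightarrow> real \<Rightarrow> real" where
  "gaussian_lr h x = exp (h * x - h\<^sup>2 / 2)"

lemma gaussian_lr_measurable [measurable]: "gaussian_lr h \<in> borel_measurable borel"
  unfolding gaussian_lr_def by measurable

lemma gaussian_lr_pos: "gaussian_lr h x > 0"
  by (simp add: gaussian_lr_def)

text \<open>Squaring doubles the shift up to a constant factor, so second moments of the ratio
  reduce to means of another ratio.\<close>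

lemma gaussian_lr_square: "(gaussian_lr h x)\<^sup>2 = exp (h\<^sup>2) * gaussian_lr (2 * h) x"
  by (simp add: gaussian_lr_def power2_eq_square flip: exp_add)

lemma std_normal_density_shift:
  "std_normal_density x * gaussian_lr h x = std_normal_density (x - h)"
proof -
  have "- x\<^sup>2 / 2 + (h * x - h\<^sup>2 / 2) = - (x - h)\<^sup>2 / 2"
    by (simp add: power2_eq_square field_simps)
  then show ?thesis
    by (simp add: std_normal_density_def gaussian_lr_def flip: exp_add)
qed

text \<open>The translation \<open>x\<close> to \<open>x + (b - a)\<close> moves the change of mean
  from the argument of \<open>f\<close> into the density, where
  \<open>std_normal_density_shift\<close> turns it into a weight.\<close>

lemma nn_integral_std_normal_shift:
  fixes f :: "real \<Rightarrow> ennreal"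
  assumes [measurable]: "f \<in> borel_measurable borel"
  shows "(\<integral>\<^sup>+x. std_normal_density x * f (a + x) \<partial>lborel) =
    (\<integral>\<^sup>+x. std_normal_density x * (gaussian_lr (a - b) x * f (b + x)) \<partial>lborel)"
proof -
  have "(\<integral>\<^sup>+x. std_normal_density x * f (a + x) \<partial>lborel) =
      (\<integral>\<^sup>+x. std_normal_density ((b - a) + 1 * x) * f (a + ((b - a) + 1 * x)) \<partial>lborel)"
    by (subst nn_integral_real_affine[of _ 1 "b - a"]) auto
  also have "\<dots> = (\<integral>\<^sup>+x. std_normal_density x * (gaussian_lr (a - b) x * f (b + x)) \<partial>lborel)"
  proof (rule nn_integral_cong)
    fix x
    have "std_normal_density ((b - a) + 1 * x) =
        std_normal_density x * gaussian_lr (a - b) x"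
      unfolding std_normal_density_shift by (simp add: algebra_simps)
    then show "std_normal_density ((b - a) + 1 * x) * f (a + ((b - a) + 1 * x)) =
        std_normal_density x * (gaussian_lr (a - b) x * f (b + x))"
      by (simp add: ennreal_mult' mult.assoc)
  qed
  finally show ?thesis .
qed

section \<open>Change of measure for the first \<open>T\<close> noisy valuations\<close>

locale gaussian_noise = prob_space M for M :: "'a measure" +
  fixes \<xi> :: "nat \<Rightarrow> 'a \<Rightarrow> real"
  assumes noise: "standard_gaussian_noise M \<xi>"
begin

lemma noise_indep: "I \<subseteq> {1..} \<Longrightarrow> indep_vars (\<lambda>_. borel) \<xi> I"
  using noise indep_vars_subset unfolding standard_gaussian_noise_def by blast

lemma noise_distributed: "1 \<le> t \<Longrightarrow> distributed M lborel (\<xi> t) std_normal_density"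
  using noise by (simp add: standard_gaussian_noise_def)

lemma noise_measurable: "1 \<le> t \<Longrightarrow> \<xi> t \<in> borel_measurable M"
  using noise_distributed[of t] by (simp add: distributed_def)

lemma nn_integral_noise_shift:
  fixes f :: "real \<Rightarrow> ennreal"
  assumes "1 \<le> t" and [measurable]: "f \<in> borel_measurable borel"
  shows "(\<integral>\<^sup>+\<omega>. gaussian_lr (a - b) (\<xi> t \<omega>) * f (b + \<xi> t \<omega>) \<partial>M) =
    (\<integral>\<^sup>+\<omega>. f (a + \<xi> t \<omega>) \<partial>M)"
  using distributed_nn_integral[OF noise_distributed[OF assms(1)], of "\<lambda>x. f (a + x)"]
    distributed_nn_integral[OF noise_distributed[OF assms(1)],
      of "\<lambda>x. gaussian_lr (a - b) x * f (b + x)"]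
    nn_integral_std_normal_shift[of f a b]
  by simp

definition signal :: "nat \<Rightarrow> real \<Rightarrow> 'a \<Rightarrow> nat \<Rightarrow> real" where
  "signal T a \<omega> = (\<lambda>t\<in>{1..T}. a + \<xi> t \<omega>)"

text \<open>By independence, the joint likelihood ratio is the product over the rounds. It is
  written in terms of the noise, so for a signal centred at \<open>b\<close> the weight towards
  \<open>a\<close> is \<open>path_lr T (a - b)\<close>.\<close>

definition path_lr :: "nat \<Rightarrow> real \<Rightarrow> 'a \<Rightarrow> real" where
  "path_lr T h \<omega> = (\<Prod>t\<in>{1..T}. gaussian_lr h (\<xi> t \<omega>))"

lemma signal_measurable [measurable]: "signal T a \<in> M \<rightarrow>\<^sub>M (\<Pi>\<^sub>M t\<in>{1..T}. borel)"
  unfolding signal_def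
  by (intro measurable_restrict borel_measurable_add borel_measurable_const noise_measurable) auto

lemma path_lr_measurable [measurable]: "path_lr T h \<in> borel_measurable M"
  unfolding path_lr_def
  by (intro borel_measurable_prod measurable_compose[OF noise_measurable gaussian_lr_measurable])
    auto

lemma path_lr_pos: "path_lr T h \<omega> > 0"
  unfolding path_lr_def by (intro prod_pos gaussian_lr_pos)

text \<open>Finite measures on the product space are determined by boxes. On a box the indicator
  factorises, and independence reduces the claim to \<open>nn_integral_noise_shift\<close> in each
  round.\<close>

lemma distr_signal_change_of_measure:
  "distr (density M (path_lr T (a - b))) (\<Pi>\<^sub>M t\<in>{1..T}. borel) (signal T b) =
    distr M (\<Pi>\<^sub>M t\<in>{1..T}. borel) (signal T a)"
    (is "?P = ?Q")
proof (rule measure_eqI_PiM_finite[of "{1..T}" _ "\<lambda>_. borel" _ "\<lambda>_. space (\<Pi>\<^sub>M t\<in>{1..T}. borel)"])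
  have box: "emeasure ?P (Pi\<^sub>E {1..T} A) = emeasure ?Q (Pi\<^sub>E {1..T} A)"
    if A: "\<And>t. t \<in> {1..T} \<Longrightarrow> A t \<in> sets borel" for A :: "nat \<Rightarrow> real set"
  proof -
    have box_sets [measurable]: "Pi\<^sub>E {1..T} A \<in> sets (\<Pi>\<^sub>M t\<in>{1..T}. borel)"
      using A by (intro sets_PiM_I_finite) auto
    \<comment> \<open>\<open>signal\<close> is extensional on \<open>{1..T}\<close>, so membership
      in the box is decided by the coordinates alone.\<close>
    have ind: "indicator (Pi\<^sub>E {1..T} A) (signal T c \<omega>) =
        (\<Prod>t\<in>{1..T}. indicator (A t) (c + \<xi> t \<omega>) :: ennreal)" for c \<omega>
      by (auto simp: signal_def PiE_iff indicator_def prod_zero_iff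
          intro!: prod.neutral[symmetric])
    have indep: "indep_vars (\<lambda>_. borel) (\<lambda>t \<omega>. f t (\<xi> t \<omega>)) {1..T}"
      if "\<And>t. t \<in> {1..T} \<Longrightarrow> f t \<in> borel_measurable borel"
      for f :: "nat \<Rightarrow> real \<Rightarrow> ennreal"
      by (rule indep_vars_compose2[OF noise_indep]) (use that in auto)
    have "emeasure ?P (Pi\<^sub>E {1..T} A) = (\<integral>\<^sup>+z. indicator (Pi\<^sub>E {1..T} A) z \<partial>?P)"
      by (rule nn_integral_indicator[symmetric]) simp
    also have "\<dots> = (\<integral>\<^sup>+\<omega>. ennreal (path_lr T (a - b) \<omega>) * indicator (Pi\<^sub>E {1..T} A) (signal T b \<omega>) \<partial>M)"
      by (subst nn_integral_distr, simp, simp, subst nn_integral_density) auto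
    also have "\<dots> = (\<integral>\<^sup>+\<omega>. (\<Prod>t\<in>{1..T}.
        ennreal (gaussian_lr (a - b) (\<xi> t \<omega>)) * indicator (A t) (b + \<xi> t \<omega>)) \<partial>M)"
      unfolding ind path_lr_def
      by (simp add: prod.distrib prod_ennreal gaussian_lr_pos less_imp_le)
    also have "\<dots> = (\<Prod>t\<in>{1..T}.
        \<integral>\<^sup>+\<omega>. ennreal (gaussian_lr (a - b) (\<xi> t \<omega>)) * indicator (A t) (b + \<xi> t \<omega>) \<partial>M)"
      by (intro indep_vars_nn_integral indep
          [of "\<lambda>t x. ennreal (gaussian_lr (a - b) x) * indicator (A t) (b + x)"])
        (use A in auto)
    also have "\<dots> = (\<Prod>t\<in>{1..T}. \<integral>\<^sup>+\<omega>. indicator (A t) (a + \<xi> t \<omega>) \<partial>M)"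
      using A by (intro prod.cong refl nn_integral_noise_shift) auto
    also have "\<dots> = (\<integral>\<^sup>+\<omega>. (\<Prod>t\<in>{1..T}. indicator (A t) (a + \<xi> t \<omega>)) \<partial>M)"
      by (intro indep_vars_nn_integral[symmetric] indep[of "\<lambda>t x. indicator (A t) (a + x)"])
        (use A in auto)
    also have "\<dots> = (\<integral>\<^sup>+z. indicator (Pi\<^sub>E {1..T} A) z \<partial>?Q)"
      unfolding ind[symmetric] by (subst nn_integral_distr) auto
    also have "\<dots> = emeasure ?Q (Pi\<^sub>E {1..T} A)"
      by (rule nn_integral_indicator) simp
    finally show ?thesis .
  qed
  then show "emeasure ?P (Pi\<^sub>E {1..T} A) = emeasure ?Q (Pi\<^sub>E {1..T} A)"
    if "\<And>t. t \<in> {1..T} \<Longrightarrow> A t \<in> sets borel" for A :: "nat \<Rightarrow> real set"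
    using that .
  interpret Q: prob_space ?Q
    by (intro prob_space_distr) simp
  \<comment> \<open>The whole space is itself a box, so \<open>?P\<close> inherits finiteness from
    the probability measure \<open>?Q\<close>.\<close>
  have "emeasure ?P (space (\<Pi>\<^sub>M t\<in>{1..T}. borel)) = emeasure ?Q (space (\<Pi>\<^sub>M t\<in>{1..T}. borel))"
    unfolding space_PiM by (rule box) auto
  then show "emeasure ?P (space (\<Pi>\<^sub>M t\<in>{1..T}. borel)) \<noteq> \<infinity>"
    by simp
qed (auto simp: space_PiM intro!: prod_algebraI_finite)

text \<open>The mean is the total mass of the reweighted law, which the change of measure from
  valuation 0 to \<open>h\<close> identifies with a probability law.\<close>

lemma has_bochner_integral_path_lr: "has_bochner_integral M (path_lr T h) 1"
proof (rule has_bochner_integral_nn_integral)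
  have "(\<integral>\<^sup>+\<omega>. path_lr T h \<omega> \<partial>M) = (\<integral>\<^sup>+\<omega>. 1 \<partial>density M (path_lr T (h - 0)))"
    by (subst nn_integral_density) auto
  also have "\<dots> = (\<integral>\<^sup>+y. 1 \<partial>distr (density M (path_lr T (h - 0)))
      (\<Pi>\<^sub>M t\<in>{1..T}. borel) (signal T 0))"
    by (rule nn_integral_distr[symmetric]) simp_all
  also have "\<dots> = (\<integral>\<^sup>+\<omega>. 1 \<partial>M)"
    unfolding distr_signal_change_of_measure by (rule nn_integral_distr) simp_all
  also have "\<dots> = ennreal 1"
    by (simp add: emeasure_space_1)
  finally show "(\<integral>\<^sup>+\<omega>. path_lr T h \<omega> \<partial>M) = ennreal 1" .
qed (simp_all add: path_lr_pos less_imp_le)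

lemma path_lr_square: "(path_lr T h \<omega>)\<^sup>2 = exp (h\<^sup>2 * T) * path_lr T (2 * h) \<omega>"
  unfolding path_lr_def prod_power_distrib
  by (simp add: gaussian_lr_square prod.distrib exp_of_nat2_mult)

text \<open>By \<open>path_lr_square\<close> only the mean of the ratio with shift
  \<open>2 * h\<close> is left, and that is 1.\<close>

lemma has_bochner_integral_path_lr_square:
  "has_bochner_integral M (\<lambda>\<omega>. (path_lr T h \<omega>)\<^sup>2) (exp (h\<^sup>2 * T))"
  unfolding path_lr_square
  using has_bochner_integral_mult_right[OF has_bochner_integral_path_lr] by simp

text \<open>With \<open>L\<close> the likelihood ratio, the difference is the mean of
  \<open>(L - 1) * (F - 1/2)\<close>, hence at most half the mean of
  \<open>\<bar>L - 1\<bar>\<close>. The inequality of arithmetic and geometric means bounds this by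
  the second moment of \<open>L\<close>.\<close>

lemma expectation_signal_diff_le:
  assumes [measurable]: "F \<in> borel_measurable (\<Pi>\<^sub>M t\<in>{1..T}. borel)"
    and F: "\<And>y. y \<in> space (\<Pi>\<^sub>M t\<in>{1..T}. borel) \<Longrightarrow> F y \<in> {0..1::real}"
  shows "expectation (\<lambda>\<omega>. F (signal T a \<omega>)) - expectation (\<lambda>\<omega>. F (signal T b \<omega>))
    \<le> exp ((a - b)\<^sup>2 * T) / 4"
proof -
  let ?L = "path_lr T (a - b)"
  have F01: "F (signal T c \<omega>) \<in> {0..1}" if "\<omega> \<in> space M" for c \<omega>
    using F measurable_space[OF signal_measurable that] by blast
  have L: "integrable M ?L" "expectation ?L = 1"
    using has_bochner_integral_path_lr by (auto simp: has_bochner_integral_iff)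
  have L2: "integrable M (\<lambda>\<omega>. (?L \<omega>)\<^sup>2)" "expectation (\<lambda>\<omega>. (?L \<omega>)\<^sup>2) = exp ((a - b)\<^sup>2 * T)"
    using has_bochner_integral_path_lr_square by (auto simp: has_bochner_integral_iff)
  have F_int: "integrable M (\<lambda>\<omega>. F (signal T b \<omega>))"
    by (rule integrable_const_bound[of _ 1]) (use F01[of _ b] in \<open>auto intro!: AE_I2\<close>)
  have LF_int: "integrable M (\<lambda>\<omega>. ?L \<omega> * F (signal T b \<omega>))"
  proof (rule Bochner_Integration.integrable_bound[OF L(1)])
    show "AE \<omega> in M. norm (?L \<omega> * F (signal T b \<omega>)) \<le> norm (?L \<omega>)"
      using F01[of _ b] path_lr_pos[of T "a - b"]
      by (auto simp: abs_mult intro!: AE_I2 mult_left_le)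
  qed simp
  have "expectation (\<lambda>\<omega>. F (signal T a \<omega>)) =
      (\<integral>y. F y \<partial>distr (density M ?L) (\<Pi>\<^sub>M t\<in>{1..T}. borel) (signal T b))"
    unfolding distr_signal_change_of_measure by (subst integral_distr) auto
  also have "\<dots> = expectation (\<lambda>\<omega>. ?L \<omega> * F (signal T b \<omega>))"
    by (subst integral_distr, simp, simp, subst integral_density)
      (auto simp: path_lr_pos less_imp_le)
  \<comment> \<open>The last summand has mean zero and centres \<open>F\<close> at \<open>1/2\<close>, the middle of its range.\<close>
  finally have "expectation (\<lambda>\<omega>. F (signal T a \<omega>)) - expectation (\<lambda>\<omega>. F (signal T b \<omega>)) =
      expectation (\<lambda>\<omega>. ?L \<omega> * F (signal T b \<omega>) - F (signal T b \<omega>) + (1 - ?L \<omega>) / 2)"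
    using L LF_int F_int prob_space by simp
  also have "\<dots> \<le> expectation (\<lambda>\<omega>. ((?L \<omega>)\<^sup>2 - 2 * ?L \<omega> + 2) / 4)"
  proof (rule integral_mono)
    fix \<omega> assume \<omega>: "\<omega> \<in> space M"
    define l f where "l = ?L \<omega>" and "f = F (signal T b \<omega>)"
    have f: "\<bar>f - 1 / 2\<bar> \<le> 1 / 2"
      using F01[OF \<omega>, of b] by (auto simp: f_def abs_if)
    have "l * f - f + (1 - l) / 2 = (l - 1) * (f - 1 / 2)"
      by (simp add: algebra_simps diff_divide_distrib)
    also have "\<dots> \<le> \<bar>l - 1\<bar> * (1 / 2)"
      using mult_left_mono[OF f, of "\<bar>l - 1\<bar>"] abs_ge_self[of "(l - 1) * (f - 1 / 2)"]
      by (simp only: abs_mult) linarith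
    \<comment> \<open>The numerator is \<open>(l - 1)\<^sup>2 + 1\<close>; this is
      \<open>2 * \<bar>x\<bar> \<le> x\<^sup>2 + 1\<close> at \<open>x = l - 1\<close>.\<close>
    also have "\<dots> \<le> (l\<^sup>2 - 2 * l + 2) / 4"
      using zero_le_power2[of "\<bar>l - 1\<bar> - 1"]
      by (simp add: power2_eq_square algebra_simps abs_if split: if_splits)
    finally show "?L \<omega> * F (signal T b \<omega>) - F (signal T b \<omega>) + (1 - ?L \<omega>) / 2
        \<le> ((?L \<omega>)\<^sup>2 - 2 * ?L \<omega> + 2) / 4"
      by (simp add: l_def f_def)
  qed (use L L2 LF_int F_int in auto)
  \<comment> \<open>Since \<open>?L\<close> has mean 1, the terms \<open>- 2 * ?L\<close> and
    \<open>2\<close> cancel in expectation.\<close>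
  also have "\<dots> = exp ((a - b)\<^sup>2 * T) / 4"
    using L L2 prob_space by simp
  finally show ?thesis .
qed

end

section \<open>Decisions as functions of the first \<open>T\<close> noisy valuations\<close>

lemma decision_cong:
  assumes "\<And>s. 1 \<le> s \<Longrightarrow> s < t \<Longrightarrow> y s = y' s"
  shows "decision \<pi> S y t = decision \<pi> S y' t"
  using assms
proof (induction t rule: less_induct)
  case (less t)
  have "observed \<pi> S y t = observed \<pi> S y' t"
    using less by (auto simp: observed_def fun_eq_iff restrict_def)
  then show ?case
    by (simp add: decision_eq_observed[of \<pi> S _ t])
qed

text \<open>Strong induction on the round: measurable earlier decisions make the history a
  measurable map into \<open>history_space t\<close>, to which the rule is applied. All rounds share
  the domain over \<open>{1..T}\<close>, so that they can be summed.\<close>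

lemma decision_measurable:
  assumes "bidding_policy \<pi>" "0 \<le> S" "1 \<le> t" "t \<le> T"
  shows "(\<lambda>y. decision \<pi> S y t) \<in> (\<Pi>\<^sub>M s\<in>{1..T}. borel) \<rightarrow>\<^sub>M count_space {0, 1}"
  using assms(3,4)
proof (induction t rule: less_induct)
  case (less t)
  have "(\<lambda>y. observed \<pi> S y t) \<in> (\<Pi>\<^sub>M s\<in>{1..T}. borel) \<rightarrow>\<^sub>M history_space t"
    unfolding observed_def history_space_def
  proof (rule measurable_restrict)
    fix s assume s: "s \<in> {1..<t}"
    then have d: "(\<lambda>y. decision \<pi> S y s) \<in> (\<Pi>\<^sub>M s\<in>{1..T}. borel) \<rightarrow>\<^sub>M count_space {0, 1}"
      using less by auto
    have "(\<lambda>y. real (decision \<pi> S y s)) \<in> borel_measurable (\<Pi>\<^sub>M s\<in>{1..T}. borel)"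
      using d by (rule measurable_compose) simp
    moreover have "(\<lambda>y. y s) \<in> borel_measurable (\<Pi>\<^sub>M s\<in>{1..T}. borel)"
      using s less.prems by (intro measurable_component_singleton) auto
    ultimately show "(\<lambda>y. (decision \<pi> S y s, real (decision \<pi> S y s) * y s))
        \<in> (\<Pi>\<^sub>M s\<in>{1..T}. borel) \<rightarrow>\<^sub>M count_space {0, 1} \<Otimes>\<^sub>M borel"
      using d by (intro measurable_Pair borel_measurable_times)
  qed
  moreover have "\<pi> S t \<in> history_space t \<rightarrow>\<^sub>M count_space {0, 1}"
    using assms less.prems by (simp add: bidding_policy_def)
  ultimately show ?case
    unfolding decision_eq_observed[of _ _ _ t] by (rule measurable_compose)
qed

definition participation_rate :: "policy \<Rightarrow> real \<Rightarrow> nat \<Rightarrow> (nat \<Rightarrow> real) \<Rightarrow> real" where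
  "participation_rate \<pi> S T y = (\<Sum>t=1..T. real (decision \<pi> S y t)) / T"

lemma participation_rate_measurable:
  assumes "bidding_policy \<pi>" "0 \<le> S"
  shows "participation_rate \<pi> S T \<in> borel_measurable (\<Pi>\<^sub>M s\<in>{1..T}. borel)"
proof -
  have "(\<lambda>y. real (decision \<pi> S y t)) \<in> borel_measurable (\<Pi>\<^sub>M s\<in>{1..T}. borel)"
    if "t \<in> {1..T}" for t
    by (rule measurable_compose[OF decision_measurable]) (use assms that in auto)
  then show ?thesis
    unfolding participation_rate_def by (intro borel_measurable_divide borel_measurable_sum) auto
qed

lemma participation_rate_bounds:
  assumes "bidding_policy \<pi>" "0 \<le> S"
  shows "participation_rate \<pi> S T y \<in> {0..1}"
proof -
  have "(\<Sum>t=1..T. real (decision \<pi> S y t)) \<le> (\<Sum>t=1..T. 1)"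
    using decision_in_01[OF assms, of _ y] by (intro sum_mono) fastforce
  then show ?thesis
    by (auto simp: participation_rate_def sum_nonneg divide_le_eq_1)
qed

lemma participation_rate_cong:
  assumes "\<And>s. 1 \<le> s \<Longrightarrow> s \<le> T \<Longrightarrow> y s = y' s"
  shows "participation_rate \<pi> S T y = participation_rate \<pi> S T y'"
  unfolding participation_rate_def using assms
  by (intro arg_cong2[where f = "(/)"] sum.cong arg_cong[where f = real] decision_cong) auto

text \<open>Regret is affine in the participation rate, so bounding its mean only takes the
  expectation of a \<open>[0, 1]\<close>-valued statistic.\<close>

lemma regret_eq_participation_rate:
  assumes "1 \<le> T"
  shows "regret \<pi> B S y T = T * (max (B - S) 0 - (B - S) * participation_rate \<pi> S T y)"
  unfolding regret_def participation_rate_def sum_distrib_right[symmetric]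
  using assms by (simp add: field_simps)

section \<open>The two competing valuations\<close>

theorem lemma21:
  fixes M :: "'a measure" and \<xi> :: "nat \<Rightarrow> 'a \<Rightarrow> real" and \<pi> :: policy and T :: nat
  assumes "prob_space M"
    and "standard_gaussian_noise M \<xi>"
    and "T \<ge> 1"
    and "bidding_policy \<pi>"
  shows "\<exists>B S :: real. B \<ge> 0 \<and> S \<ge> 0 \<and>
    (\<integral>\<omega>. regret \<pi> B S (\<lambda>t. B + \<xi> t \<omega>) T \<partial>M) \<ge> 1 / 36 * sqrt (real T)"
proof -
  interpret gaussian_noise M \<xi>
    using assms by (simp add: gaussian_noise_def gaussian_noise_axioms_def)
  define \<delta> where "\<delta> = 1 / (4 * sqrt T)"
  define F where "F = participation_rate \<pi> 1 T"
  define E where "E B = expectation (\<lambda>\<omega>. F (signal T B \<omega>))" for B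
  \<comment> \<open>The bound \<open>\<delta> \<le> 1\<close> keeps the valuation
    \<open>1 - \<delta>\<close> nonnegative; the last equation gives the exponent in
    \<open>expectation_signal_diff_le\<close>.\<close>
  have \<delta>: "0 < \<delta>" "\<delta> \<le> 1" "T * \<delta> = sqrt T / 4" "(1 + \<delta> - (1 - \<delta>))\<^sup>2 * T = 1 / 4"
  proof -
    have "1 \<le> sqrt T"
      using assms(3) by simp
    then have "1 \<le> sqrt T * 4"
      by linarith
    then show "0 < \<delta>" "\<delta> \<le> 1" "T * \<delta> = sqrt T / 4" "(1 + \<delta> - (1 - \<delta>))\<^sup>2 * T = 1 / 4"
      using assms(3) by (auto simp: \<delta>_def field_simps power2_eq_square)
  qed
  have F_meas [measurable]: "F \<in> borel_measurable (\<Pi>\<^sub>M s\<in>{1..T}. borel)"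
    unfolding F_def using assms(4) by (intro participation_rate_measurable) auto
  have F01: "F y \<in> {0..1}" for y
    unfolding F_def using assms(4) by (intro participation_rate_bounds) auto
  have F_int: "integrable M (\<lambda>\<omega>. F (signal T B \<omega>))" for B
    by (rule integrable_const_bound[of _ 1]) (use F01 in \<open>auto intro!: AE_I2\<close>)
  \<comment> \<open>The regret is run on an unrestricted sequence, \<open>F\<close> on its
    restriction to \<open>{1..T}\<close>; they agree because only rounds up to \<open>T\<close>
    matter.\<close>
  have regret: "(\<integral>\<omega>. regret \<pi> B 1 (\<lambda>t. B + \<xi> t \<omega>) T \<partial>M) = T * (max (B - 1) 0 - (B - 1) * E B)"
    for B
  proof -
    have "participation_rate \<pi> 1 T (\<lambda>t. B + \<xi> t \<omega>) = F (signal T B \<omega>)" for \<omega>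
      unfolding F_def by (intro participation_rate_cong) (auto simp: signal_def)
    then show ?thesis
      using F_int prob_space by (simp add: regret_eq_participation_rate[OF assms(3)] E_def)
  qed
  \<comment> \<open>\<open>exp x \<le> 1 + x + x\<^sup>2\<close> on the unit interval gives
    21/16.\<close>
  have "exp (1 / 4 :: real) \<le> 2"
    using exp_bound[of "1 / 4"] by (simp add: power2_eq_square)
  then have "E (1 + \<delta>) - E (1 - \<delta>) \<le> 1 / 2"
    using expectation_signal_diff_le[OF F_meas F01, of "1 + \<delta>" "1 - \<delta>"]
    unfolding \<delta>(4) E_def by linarith
  \<comment> \<open>The two quantities sum to at least 1/2.\<close>
  then consider "1 - E (1 + \<delta>) \<ge> 1 / 4" | "E (1 - \<delta>) \<ge> 1 / 4"
    by linarith
  then show ?thesis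
  proof cases
    case 1
    \<comment> \<open>The right-hand side is \<open>sqrt T / 16\<close>, which leaves slack in the
      constant.\<close>
    have "1 / 36 * sqrt T \<le> (T * \<delta>) * (1 / 4)"
      unfolding \<delta>(3) by simp
    also have "\<dots> \<le> (T * \<delta>) * (1 - E (1 + \<delta>))"
      using 1 \<delta>(1) by (intro mult_left_mono) auto
    also have "\<dots> = (\<integral>\<omega>. regret \<pi> (1 + \<delta>) 1 (\<lambda>t. 1 + \<delta> + \<xi> t \<omega>) T \<partial>M)"
      unfolding regret using \<delta>(1) by (simp add: algebra_simps)
    finally show ?thesis
      using \<delta>(1) by (intro exI[of _ "1 + \<delta>"] exI[of _ 1]) auto
  next
    case 2
    have "1 / 36 * sqrt T \<le> (T * \<delta>) * (1 / 4)"
      unfolding \<delta>(3) by simp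
    also have "\<dots> \<le> (T * \<delta>) * E (1 - \<delta>)"
      using 2 \<delta>(1) by (intro mult_left_mono) auto
    \<comment> \<open>Below the price the maximum in the regret vanishes, and each participation
      costs \<open>\<delta>\<close>.\<close>
    also have "\<dots> = (\<integral>\<omega>. regret \<pi> (1 - \<delta>) 1 (\<lambda>t. 1 - \<delta> + \<xi> t \<omega>) T \<partial>M)"
      unfolding regret using \<delta>(1) by simp
    finally show ?thesis
      using \<delta>(1,2) by (intro exI[of _ "1 - \<delta>"] exI[of _ 1]) auto
  qed
qed

end
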